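(* For every integer $n\ge 1$, $$\varphi(1+\varphi(2+\varphi(3+\cdots+\varphi(n)\cdots)))=\begin{cases}1 & n=1,2,\\ 2 & n=3,4,\\ 4 & n\ge 5.\end{cases}$$
   Context: $\varphi$ denotes Euler's totient function. Precisely, the left-hand side is $x_0$, where $x_n=0$ and $x_{k-1}=\varphi(k+x_k)$ for $k=n,n-1,\dots,1$. *)

theory Defs
  imports "HOL-Number_Theory.Totient"
begin

(* For k \<le> n, nested_totient n k is x_k, where x_n = 0 and
   x_(k-1) = totient (k + x_k) for k = n, ..., 1; for k > n the value 0 is junk. *)
function nested_totient :: "nat \<Rightarrow> nat \<Rightarrow> nat" where
  "nested_totient n k =
     (if k < n then totient (Suc k + nested_totient n (Suc k)) else 0)"
  by auto
termination
  by (relation "measure (\<lambda>(n, k). n - k)") auto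

declare nested_totient.simps [simp del]

lemma nested_totient_top: "nested_totient n n = 0"
  by (simp add: nested_totient.simps)

lemma nested_totient_step:
  assumes "k \<in> {1..n}"
  shows "nested_totient n (k - 1) = totient (k + nested_totient n k)"
proof -
  have "Suc (k - 1) = k" "k - 1 < n"
    using assms by auto
  then show ?thesis
    by (subst nested_totient.simps) simp
qed

end

theory Submission imports Defs
begin

text \<open>
  All \<open>x\<^sub>j\<close> with \<open>j \<ge> 2\<close> are even, because totients of numbers above 2 are. At odd indices the argument of the totient is therefore even, and halving there against the
  trivial bound at even indices gives \<open>x\<^sub>j \<le> 2 j + 6\<close> for odd \<open>j\<close>. In particular \<open>x\<^sub>5\<close> is even and
  at most 16, and it is not the nontotient 14; each remaining value of \<open>x\<^sub>5\<close> leads to \<open>x\<^sub>0 = 4\<close>.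
\<close>

text \<open>Doubling an odd \<open>k\<close> keeps its totient and doubling an even \<open>k\<close>
  doubles it, so repeated halving reduces to \<open>totient k \<le> k\<close>.\<close>

lemma totient_le_half_of_even:
  assumes "even m"
  shows "2 * totient m \<le> m"
  using assms
proof (induction m rule: less_induct)
  case (less m)
  obtain k where k: "m = 2 * k" using less.prems by blast
  show ?case
  proof (cases "even k \<and> k > 0")
    case True
    then have "2 * totient k \<le> k" using less.IH[of k] k by simp
    then show ?thesis using True k totient_double[of k] by simp
  next
    case False
    then show ?thesis using k totient_double[of k] totient_le[of k] by auto
  qed
qed

text \<open>By the halving bound only 28, 30 and 32 could have totient 14.\<close>

lemma totient_neq_14_of_even:
  assumes "even m" "m \<le> 32"
  shows "totient m \<noteq> 14"
proof
  assume "totient m = 14"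
  moreover from this have "28 \<le> m" using totient_le_half_of_even[OF assms(1)] by simp
  then have "m = 28 \<or> m = 30 \<or> m = 32" using assms by presburger
  moreover have "totient 28 = 12" "totient 30 = 8" "totient 32 = 16" by code_simp+
  ultimately show False by auto
qed

lemma nested_totient_less:
  assumes "k < n"
  shows "nested_totient n k = totient (Suc k + nested_totient n (Suc k))"
  using assms by (subst nested_totient.simps) simp

lemma nested_totient_ge: "n \<le> k \<Longrightarrow> nested_totient n k = 0"
  by (subst nested_totient.simps) simp

lemma even_nested_totient:
  assumes "k \<ge> 2"
  shows "even (nested_totient n k)"
proof (cases "k < n")
  case True
  then show ?thesis using assms by (simp add: nested_totient_less totient_even)
qed (simp add: nested_totient_ge)

lemma nested_totient_le:
  assumes "k > 0"
  shows "nested_totient n k \<le> k + nested_totient n (Suc k)"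
proof (cases "k < n")
  case True
  then show ?thesis
    using assms totient_less[of "Suc k + nested_totient n (Suc k)"]
    by (simp add: nested_totient_less)
qed (simp add: nested_totient_ge)

text \<open>Descending two indices at a time gives
  \<open>2 * x\<^sub>j \<le> 2 * (j + 1) + x\<^sub>j\<^sub>+\<^sub>2\<close>; 6 is the least
  constant \<open>c\<close> for which \<open>2 * j + c\<close> reproduces itself under this
  inequality.\<close>

lemma nested_totient_odd_le:
  assumes "odd j"
  shows "nested_totient n j \<le> 2 * j + 6"
  using assms
proof (induction "n - j" arbitrary: j rule: less_induct)
  case less
  show ?case
  proof (cases "j < n")
    case True
    \<comment> \<open>For \<open>j = n - 1\<close> this index lies beyond \<open>n\<close>, where
      the value is the default 0.\<close>
    have "nested_totient n (Suc (Suc j)) \<le> 2 * Suc (Suc j) + 6"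
      using less.hyps[of "Suc (Suc j)"] less.prems True by simp
    moreover have "nested_totient n (Suc j) \<le> Suc j + nested_totient n (Suc (Suc j))"
      by (rule nested_totient_le) simp
    moreover have "j > 0"
      using less.prems by (rule odd_pos)
    then have "2 * nested_totient n j \<le> Suc j + nested_totient n (Suc j)"
      using less.prems True even_nested_totient[of "Suc j" n]
      by (simp add: nested_totient_less totient_le_half_of_even del: add_Suc)
    ultimately show ?thesis by simp
  qed (simp add: nested_totient_ge)
qed

text \<open>Excluding 14 is essential: \<open>x\<^sub>5 = 14\<close> would lead to
  \<open>x\<^sub>0 = 6\<close>.\<close>

lemma nested_totient_5_cases: "nested_totient n 5 \<in> {0, 2, 4, 6, 8, 10, 12, 16}"
proof -
  have "nested_totient n 5 \<noteq> 14"
  proof (cases "5 < n")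
    case True
    \<comment> \<open>Together these give
      \<open>6 + x\<^sub>6 \<le> 6 + 6 + 20 = 32\<close>.\<close>
    have "nested_totient n 6 \<le> 6 + nested_totient n 7" "nested_totient n 7 \<le> 20"
      using nested_totient_le[of 6 n] nested_totient_odd_le[of 7 n] by simp_all
    then have "totient (6 + nested_totient n 6) \<noteq> 14"
      using even_nested_totient[of 6 n] by (intro totient_neq_14_of_even) simp_all
    then show ?thesis using True nested_totient_less[of 5 n] by simp
  qed (simp add: nested_totient_ge)
  moreover have "nested_totient n 5 \<le> 16" "even (nested_totient n 5)"
    using nested_totient_odd_le[of 5 n] even_nested_totient[of 5 n] by simp_all
  ultimately show ?thesis by simp presburger
qed

lemma nested_totient_0_of_ge_5:
  assumes "n \<ge> 5"
  shows "nested_totient n 0 = 4"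
proof -
  let ?f = "\<lambda>x. totient (1 + totient (2 + totient (3 + totient (4 + totient (5 + x)))))"
  have "nested_totient n 0 = ?f (nested_totient n 5)"
    using assms nested_totient_step[of 1 n] nested_totient_step[of 2 n] nested_totient_step[of 3 n]
      nested_totient_step[of 4 n] nested_totient_step[of 5 n]
    by simp
  \<comment> \<open>All eight chains reach \<open>x\<^sub>2 = 6\<close> or
    \<open>x\<^sub>2 = 10\<close>, and they merge because 8 and 12 both have totient 4.\<close>
  moreover have "totient 10 = 4" "totient 11 = 10" "totient 12 = 4" "totient 13 = 12"
    "totient 14 = 6" "totient 15 = 8" "totient 16 = 8" "totient 17 = 16" "totient 20 = 8"
    "totient 21 = 12"
    by code_simp+
  ultimately show ?thesis using nested_totient_5_cases[of n] by auto
qed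

theorem theorem2p2:
  fixes n :: nat
  assumes "n \<ge> 1"
  shows "nested_totient n 0 =
    (if n = 1 \<or> n = 2 then 1 else if n = 3 \<or> n = 4 then 2 else 4)"
proof (cases "n \<ge> 5")
  case True
  then show ?thesis using nested_totient_0_of_ge_5 by simp
next
  case False
  then have "n \<in> {1, 2, 3, 4}" using assms by auto
  moreover have "nested_totient 1 0 = 1" "nested_totient 2 0 = 1"
    "nested_totient 3 0 = 2" "nested_totient 4 0 = 2"
    by code_simp+
  ultimately show ?thesis by auto
qed

end
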